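(* Let $n\ge0$ be an integer and $T_n=\frac{1}{n+1}\binom{3n+1}{n}$. Then $T_n$ is not divisible by $3$ if and only if the base-$3$ representation of $n$ is weakly increasing from left to right (from the most significant digit to the least significant digit). More precisely, $$T_n\equiv\begin{cases}1\pmod 3,& n=0\text{ or }n=(2\cdots2)_3\ (\text{all ternary digits equal to }2),\\ 2\pmod3,& n=(\underbrace{1\cdots1}_{i}\underbrace{2\cdots2}_{j})_3\text{ with } i\ge1,\ j\ge0,\\ 0\pmod3,&\text{otherwise.}\end{cases}$$
   Context: The numbers $T_n=\frac{1}{n+1}\binom{3n+1}{n}$, $n\ge0$, are the $(3,2)$-Raney numbers; they are integers. $(a_k\cdots a_0)_3$ denotes the integer $\sum_i a_i3^i$ with ternary digits $a_i\in\{0,1,2\}$. *)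

theory Defs
  imports "HOL-Number_Theory.Cong"
begin

text \<open>The division in \<open>raney32\<close> is exact by the lemma following it.\<close>

definition raney32 :: "nat \<Rightarrow> nat" where
  "raney32 n = ((3 * n + 1) choose n) div (n + 1)"

lemma raney32_exact: "(n + 1) * raney32 n = (3 * n + 1) choose n"
proof -
  have "Suc n * (Suc (3 * n) choose Suc n) = (2 * n + 1) * (Suc (3 * n) choose n)"
    using binomial_absorption[of n "3 * n + 1"] binomial_absorb_comp[of "3 * n + 1" n]
    by simp
  then have "n + 1 dvd (2 * n + 1) * ((3 * n + 1) choose n)"
    by (metis Suc_eq_plus1 dvd_triv_left)
  moreover have "coprime (n + 1) (2 * n + 1)"
  proof (rule coprimeI)
    fix c assume "c dvd n + 1" "c dvd 2 * n + 1"
    then have "c dvd 2 * (n + 1) - (2 * n + 1)"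
      by (intro dvd_diff_nat dvd_mult)
    then show "is_unit c" by simp
  qed
  ultimately have "n + 1 dvd (3 * n + 1) choose n"
    using coprime_dvd_mult_right_iff by blast
  then show ?thesis
    unfolding raney32_def by (rule dvd_mult_div_cancel)
qed

text \<open>Digit lists are written as on paper, most significant digit first, so that the digit
  of weight \<open>3 ^ i\<close> is the \<open>i\<close>-th entry of the reversed list.\<close>

definition ternary :: "nat list \<Rightarrow> nat" where
  "ternary ds = (\<Sum>i<length ds. rev ds ! i * 3 ^ i)"

text \<open>The base-3 representation without leading zeros; that of \<open>0\<close> is the single digit \<open>0\<close>.\<close>

fun ternary_digits :: "nat \<Rightarrow> nat list" where
  "ternary_digits n = (if n < 3 then [n] else ternary_digits (n div 3) @ [n mod 3])"

declare ternary_digits.simps [simp del]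

lemma ternary_snoc: "ternary (ds @ [d]) = d + 3 * ternary ds"
  unfolding ternary_def
  by (simp add: sum.lessThan_Suc_shift sum_distrib_left ac_simps del: sum.lessThan_Suc)

lemma ternary_ternary_digits: "ternary (ternary_digits n) = n"
proof (induction n rule: ternary_digits.induct)
  case (1 n)
  show ?case
  proof (cases "n < 3")
    case True
    then show ?thesis by (simp add: ternary_digits.simps[of n] ternary_def)
  next
    case False
    with 1 show ?thesis by (simp add: ternary_digits.simps[of n] ternary_snoc)
  qed
qed

lemma set_ternary_digits: "set (ternary_digits n) \<subseteq> {0, 1, 2}"
proof (induction n rule: ternary_digits.induct)
  case (1 n)
  have "n mod 3 \<in> {0, 1, 2}" by auto
  with 1 show ?case
    by (cases "n < 3") (auto simp: ternary_digits.simps[of n])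
qed

lemma hd_ternary_digits: "ternary_digits n \<noteq> [] \<and> (n > 0 \<longrightarrow> hd (ternary_digits n) \<noteq> 0)"
proof (induction n rule: ternary_digits.induct)
  case (1 n)
  then show ?case
    by (cases "n < 3") (auto simp: ternary_digits.simps[of n] div_greater_zero_iff)
qed

end

theory Submission
  imports Defs
begin

text \<open>Since \<open>(n + 1) * ((3n+1) choose (n + 1)) = (2n + 1) * ((3n+1) choose n)\<close>, the
  number \<open>T n\<close> equals \<open>2 * ((3n+1) choose n) - ((3n+1) choose (n + 1))\<close>. Lucas' congruence
  applied to both coefficients gives, modulo 3, with \<open>U m = (3m+1) choose m\<close>,
  \<open>T (3m) = [m = 0]\<close>, \<open>T (3m+1) = 2 * U m\<close>, \<open>T (3m+2) = T m\<close>, and likewise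
  \<open>U (3m) = [m = 0]\<close>, \<open>U (3m+1) = U m\<close>, \<open>U (3m+2) = 0\<close>. These recursions read off the
  ternary digits from the least significant end.\<close>

section \<open>Lucas' congruence, one digit at a time\<close>

text \<open>In Vandermonde's convolution the prime divides \<open>p choose j\<close> for
  \<open>0 < j < p\<close>, so only the terms \<open>j = 0\<close> and \<open>j = p\<close>
  survive.\<close>

lemma binomial_add_prime_cong:
  fixes p :: nat
  assumes "prime p"
  shows "[(N + p) choose k = (N choose k) + (if p \<le> k then N choose (k - p) else 0)] (mod p)"
proof -
  let ?f = "\<lambda>j. (p choose j) * (N choose (k - j))"
  have p: "0 < p" using assms prime_gt_0_nat by blast
  have "(N + p) choose k = (\<Sum>j\<le>k. ?f j)"
    using vandermonde[of p N k] by (simp add: add.commute)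
  also have "[(\<Sum>j\<le>k. ?f j) = (\<Sum>j\<le>k. if j \<in> {0, p} then ?f j else 0)] (mod p)"
  proof (intro cong_sum)
    fix j
    show "[?f j = (if j \<in> {0, p} then ?f j else 0)] (mod p)"
      using dvd_choose_prime[of j p] assms
      by (cases "j < p") (auto simp: cong_0_iff binomial_eq_0)
  qed
  also have "(\<Sum>j\<le>k. if j \<in> {0, p} then ?f j else 0) = sum ?f ({..k} \<inter> {0, p})"
    by (rule sum.inter_restrict[symmetric]) simp
  also have "{..k} \<inter> {0, p} = (if p \<le> k then {0, p} else {0})"
    by auto
  also have "sum ?f \<dots> = (N choose k) + (if p \<le> k then N choose (k - p) else 0)"
    using p by simp
  finally show ?thesis .
qed

text \<open>Adding \<open>p\<close> to the upper index acts on the quotients \<open>n\<close> and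
  \<open>q\<close> like Pascal's rule and leaves the remainders \<open>a\<close> and
  \<open>r\<close> alone, so induction on \<open>n\<close> works.\<close>

lemma Lucas_step:
  fixes p :: nat
  assumes p: "prime p" and "a < p" "r < p"
  shows "[(p * n + a) choose (p * q + r) = (n choose q) * (a choose r)] (mod p)"
proof (induction n arbitrary: q)
  case 0
  then show ?case
    using assms by (cases q) (auto simp: binomial_eq_0)
next
  case (Suc n)
  let ?N = "p * n + a"
  have step: "[(?N + p) choose k = (?N choose k) + (if p \<le> k then ?N choose (k - p) else 0)] (mod p)" for k
    by (rule binomial_add_prime_cong[OF p])
  show ?case
  proof (cases q)
    case 0
    \<comment> \<open>Since \<open>r < p\<close>, the shifted term of \<open>step\<close> is
      0.\<close>
    then show ?thesis
      using step[of r] Suc[of 0] \<open>r < p\<close> by (auto simp: ac_simps intro: cong_trans)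
  next
    case (Suc q')
    have "[(?N + p) choose (p * q + r) = (?N choose (p * q + r)) + (?N choose (p * q' + r))] (mod p)"
      using step[of "p * q + r"] Suc by (simp add: ac_simps)
    also have "[(?N choose (p * q + r)) + (?N choose (p * q' + r)) = (n choose q) * (a choose r) + (n choose q') * (a choose r)] (mod p)"
      by (intro cong_add Suc.IH)
    finally show ?thesis
      using Suc by (simp add: algebra_simps)
  qed
qed

lemmas Lucas_step_3 = Lucas_step[of "3 :: nat", simplified]

section \<open>Recursions modulo 3\<close>

text \<open>As \<open>3 * m\<close> ends in the digit 0, a nonzero last digit of \<open>m\<close>
  gives the factor 0; otherwise \<open>m = 3 * q\<close>, and \<open>m choose q\<close> is the same
  expression for the smaller \<open>q\<close>.\<close>

lemma cong_binomial_triple: "[(3 * m) choose m = of_bool (m = 0)] (mod 3)"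
proof (induction m rule: less_induct)
  case (less m)
  define q r where "q = m div 3" and "r = m mod 3"
  have m: "m = 3 * q + r" and r: "r < 3" by (auto simp: q_def r_def)
  have *: "[(3 * m) choose m = (m choose q) * (0 choose r)] (mod 3)"
    using Lucas_step_3[of 0 r m q] r m by simp
  consider "m = 0" | "r \<noteq> 0" | "r = 0" "q < m" using m by force
  then show ?case
  proof cases
    case 3
    then show ?thesis using * less[of q] m by (auto intro: cong_trans)
  qed (use * m in \<open>auto simp: binomial_eq_0\<close>)
qed

text \<open>For \<open>n = 3 * m + d\<close> the upper index \<open>3 * n + 1\<close> ends in 1, so
  Lucas' congruence gives \<open>n choose m\<close> times \<open>1 choose d\<close>, and the latter
  is 1, 1, 0 for \<open>d\<close> = 0, 1, 2.\<close>

lemma binomial_raney_recursion: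
  shows "[(3 * (3 * m) + 1) choose (3 * m) = of_bool (m = 0)] (mod 3)"
    and "[(3 * (3 * m + 1) + 1) choose (3 * m + 1) = (3 * m + 1) choose m] (mod 3)"
    and "[(3 * (3 * m + 2) + 1) choose (3 * m + 2) = 0] (mod 3)"
proof -
  show "[(3 * (3 * m) + 1) choose (3 * m) = of_bool (m = 0)] (mod 3)"
    using Lucas_step_3[of 1 0 "3 * m" m] cong_binomial_triple[of m] by (auto intro: cong_trans)
  show "[(3 * (3 * m + 1) + 1) choose (3 * m + 1) = (3 * m + 1) choose m] (mod 3)"
    using Lucas_step_3[of 1 1 "3 * m + 1" m] by simp
  show "[(3 * (3 * m + 2) + 1) choose (3 * m + 2) = 0] (mod 3)"
    using Lucas_step_3[of 1 2 "3 * m + 2" m] by (simp add: binomial_eq_0)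
qed

text \<open>Scaled by \<open>n + 1\<close>, the coefficients on the left add up as 1 + (2n + 1) =
  2(n + 1). The additive form avoids truncated subtraction.\<close>

lemma raney32_eq: "raney32 n + ((3 * n + 1) choose (n + 1)) = 2 * ((3 * n + 1) choose n)"
proof -
  have "(n + 1) * ((3 * n + 1) choose (n + 1)) = (2 * n + 1) * ((3 * n + 1) choose n)"
    using binomial_absorption[of n "3 * n + 1"] binomial_absorb_comp[of "3 * n + 1" n]
    by simp
  then have "(n + 1) * (raney32 n + ((3 * n + 1) choose (n + 1))) = (n + 1) * (2 * ((3 * n + 1) choose n))"
    using raney32_exact[of n] by (simp add: algebra_simps)
  then show ?thesis by (subst (asm) mult_cancel1) simp
qed

lemma raney32_cong:
  assumes b: "[(3 * n + 1) choose n = b] (mod 3)"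
    and a: "[(3 * n + 1) choose (n + 1) = a] (mod 3)"
    and x: "[2 * b = x + a] (mod 3)"
  shows "[raney32 n = x] (mod 3)"
proof -
  have "[raney32 n + a = raney32 n + ((3 * n + 1) choose (n + 1))] (mod 3)"
    by (intro cong_add cong_refl cong_sym[OF a])
  also have "raney32 n + ((3 * n + 1) choose (n + 1)) = 2 * ((3 * n + 1) choose n)"
    by (rule raney32_eq)
  also have "[2 * ((3 * n + 1) choose n) = 2 * b] (mod 3)"
    by (intro cong_mult cong_refl b)
  also note x
  finally show ?thesis by (simp add: cong_add_rcancel_nat)
qed

lemma raney32_recursion:
  shows "[raney32 (3 * m) = of_bool (m = 0)] (mod 3)"
    and "[raney32 (3 * m + 1) = 2 * ((3 * m + 1) choose m)] (mod 3)"
    and "[raney32 (3 * m + 2) = raney32 m] (mod 3)"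
proof -
  have "[(3 * (3 * m) + 1) choose (3 * m + 1) = (3 * m) choose m] (mod 3)"
    using Lucas_step_3[of 1 1 "3 * m" m] by simp
  then have "[(3 * (3 * m) + 1) choose (3 * m + 1) = of_bool (m = 0)] (mod 3)"
    using cong_binomial_triple[of m] by (rule cong_trans)
  then show "[raney32 (3 * m) = of_bool (m = 0)] (mod 3)"
    by (rule raney32_cong[OF binomial_raney_recursion(1)]) (simp add: numeral_2_eq_2)
next
  have "[(3 * (3 * m + 1) + 1) choose (3 * m + 1 + 1) = 0] (mod 3)"
    using Lucas_step_3[of 1 2 "3 * m + 1" m] by (simp add: binomial_eq_0)
  then show "[raney32 (3 * m + 1) = 2 * ((3 * m + 1) choose m)] (mod 3)"
    by (rule raney32_cong[OF binomial_raney_recursion(2)]) simp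
next
  \<comment> \<open>The lower index \<open>n + 1\<close> now carries: its last digit is 0 and its
    quotient is \<open>m + 1\<close>.\<close>
  have "3 * (m + 1) = 3 * m + 2 + 1" by simp
  then have "[(3 * (3 * m + 2) + 1) choose (3 * m + 2 + 1) = (3 * m + 2) choose (m + 1)] (mod 3)"
    using Lucas_step_3[of 1 0 "3 * m + 2" "m + 1"]
    by (metis add_0_right binomial_n_0 mult_1_right one_less_numeral_iff semiring_norm(77) zero_less_numeral)
  then show "[raney32 (3 * m + 2) = raney32 m] (mod 3)"
  proof (rule raney32_cong[OF binomial_raney_recursion(3)])
    \<comment> \<open>Pascal's rule splits \<open>(3 * m + 2) choose (m + 1)\<close>; one part
      combines with \<open>raney32 m\<close> to twice the other part.\<close>
    have eq: "raney32 m + ((3 * m + 2) choose (m + 1)) = 3 * ((3 * m + 1) choose m)"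
      using raney32_eq[of m] by simp
    show "[2 * 0 = raney32 m + ((3 * m + 2) choose (m + 1))] (mod 3)"
      unfolding eq by (simp add: cong_def)
  qed
qed

section \<open>Residues on the digit strings 1...12...2\<close>

lemma nat_mod3_cases [case_names 0 1 2]:
  fixes n :: nat
  obtains m where "n = 3 * m" | m where "n = 3 * m + 1" | m where "n = 3 * m + 2"
proof -
  have "n = 3 * (n div 3) + n mod 3" by simp
  moreover have "n mod 3 = 0 \<or> n mod 3 = 1 \<or> n mod 3 = 2" by auto
  ultimately show ?thesis using that by (metis add_0_right)
qed

lemma ternary_Nil [simp]: "ternary [] = 0"
  by (simp add: ternary_def)

lemma ternary_replicate_Suc [simp]:
  "ternary (replicate (Suc j) d) = d + 3 * ternary (replicate j d)"
  "ternary (ds @ replicate (Suc j) d) = d + 3 * ternary (ds @ replicate j d)"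
  by (simp_all flip: ternary_snoc replicate_append_same)

lemma binomial_raney_ones: "[(3 * ternary (replicate i 1) + 1) choose ternary (replicate i 1) = 1] (mod 3)"
proof (induction i)
  case (Suc i)
  then show ?case
    using binomial_raney_recursion(2)[of "ternary (replicate i 1)"]
    by (auto simp: add.commute simp del: replicate_Suc intro: cong_trans)
qed simp

text \<open>Descent: a last digit 2 gives residue 0, a last digit 0 does so unless
  \<open>m = 0\<close> (the empty string), and a last digit 1 can be removed.\<close>

lemma binomial_raney_nonzero:
  assumes "\<not> [(3 * m + 1) choose m = 0] (mod 3)"
  obtains i where "m = ternary (replicate i 1)"
proof -
  have "\<exists>i. m = ternary (replicate i 1)"
    using assms
  proof (induction m rule: less_induct)
    case (less m)
    show ?case
    proof (cases m rule: nat_mod3_cases)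
      case (0 k)
      then show ?thesis
        using less.prems binomial_raney_recursion(1)[of k]
        by (cases "k = 0") (auto intro!: exI[of _ 0])
    next
      case (1 k)
      then have "\<not> [(3 * k + 1) choose k = 0] (mod 3)"
        using less.prems binomial_raney_recursion(2)[of k] cong_trans by blast
      then obtain i where "k = ternary (replicate i 1)"
        using less.IH[of k] 1 by auto
      then show ?thesis
        using 1 by (intro exI[of _ "Suc i"]) (simp del: replicate_Suc)
    next
      case (2 k)
      then show ?thesis using less.prems binomial_raney_recursion(3) by blast
    qed
  qed
  then show thesis using that by blast
qed

lemma raney32_twos: "[raney32 (ternary (replicate j 2)) = 1] (mod 3)"
proof (induction j)
  case 0
  then show ?case by (simp add: raney32_def)
next
  case (Suc j)
  then show ?case
    using raney32_recursion(3)[of "ternary (replicate j 2)"]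
    by (auto simp: add.commute simp del: replicate_Suc intro: cong_trans)
qed

lemma raney32_ones_twos:
  assumes "1 \<le> i"
  shows "[raney32 (ternary (replicate i 1 @ replicate j 2)) = 2] (mod 3)"
proof (induction j)
  case 0
  \<comment> \<open>The last 1 is spent on passing from \<open>raney32\<close> to the binomial
    coefficient, with factor 2; the other \<open>i'\<close> ones contribute 1.\<close>
  obtain i' where i: "i = Suc i'" using assms by (cases i) auto
  let ?m = "ternary (replicate i' 1)"
  have "[raney32 (3 * ?m + 1) = 2 * ((3 * ?m + 1) choose ?m)] (mod 3)"
    by (rule raney32_recursion)
  also have "[2 * ((3 * ?m + 1) choose ?m) = 2 * 1] (mod 3)"
    by (intro cong_mult cong_refl binomial_raney_ones)
  finally show ?case
    by (simp add: i add.commute numeral_2_eq_2 del: replicate_Suc)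
next
  case (Suc j)
  then show ?case
    using raney32_recursion(3)[of "ternary (replicate i 1 @ replicate j 2)"]
    by (auto simp: add.commute simp del: replicate_Suc intro: cong_trans)
qed

text \<open>Reading from the right, final twos are removed freely; the first 1 passes to the
  binomial coefficient, which tolerates only further ones. A final 0 leaves just
  \<open>n = 0\<close>.\<close>

lemma raney32_nonzero:
  assumes "\<not> [raney32 n = 0] (mod 3)"
  shows "(\<exists>j. n = ternary (replicate j 2)) \<or>
    (\<exists>i\<ge>1. \<exists>j. n = ternary (replicate i 1 @ replicate j 2))"
  using assms
proof (induction n rule: less_induct)
  case (less n)
  show ?case
  proof (cases n rule: nat_mod3_cases)
    case (0 m)
    then show ?thesis
      using less.prems raney32_recursion(1)[of m]
      by (cases "m = 0") (auto intro!: exI[of _ 0])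
  next
    case (1 m)
    have "\<not> [(3 * m + 1) choose m = 0] (mod 3)"
    proof
      assume "[(3 * m + 1) choose m = 0] (mod 3)"
      then have "[2 * ((3 * m + 1) choose m) = 2 * 0] (mod 3)"
        by (intro cong_mult cong_refl)
      then show False
        using less.prems 1 raney32_recursion(2)[of m] cong_trans by fastforce
    qed
    then obtain i where "m = ternary (replicate i 1)"
      by (rule binomial_raney_nonzero)
    then have "n = ternary (replicate (Suc i) 1 @ replicate 0 2)"
      using 1 by (simp del: replicate_Suc)
    then show ?thesis
      by (intro disjI2 exI[of _ "Suc i"] conjI exI[of _ 0]) simp_all
  next
    case (2 m)
    then have "\<not> [raney32 m = 0] (mod 3)"
      using less.prems raney32_recursion(3)[of m] cong_trans by blast
    with less.IH[of m] 2 consider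
      j where "m = ternary (replicate j 2)"
      | i j where "i \<ge> 1" "m = ternary (replicate i 1 @ replicate j 2)"
      by auto
    then show ?thesis
    proof cases
      case (1 j)
      then have "n = ternary (replicate (Suc j) 2)" using 2 by (simp del: replicate_Suc)
      then show ?thesis by blast
    next
      case (2 i j)
      then have "n = ternary (replicate i 1 @ replicate (Suc j) 2)"
        using \<open>n = 3 * m + 2\<close> by (simp del: replicate_Suc)
      then show ?thesis using \<open>i \<ge> 1\<close> by blast
    qed
  qed
qed

section \<open>Divisibility by 3 and sorted digits\<close>

lemma ternary_digits_snoc:
  assumes "0 < m" "d < 3"
  shows "ternary_digits (3 * m + d) = ternary_digits m @ [d]"
  using assms by (subst ternary_digits.simps) auto

lemma ternary_digits_less: "n < 3 \<Longrightarrow> ternary_digits n = [n]"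
  by (subst ternary_digits.simps) simp

text \<open>The leading digit is nonzero, and it is the smallest one in a sorted list.\<close>

lemma sorted_ternary_digits_pos:
  assumes "0 < n" "sorted (ternary_digits n)" "d \<in> set (ternary_digits n)"
  shows "0 < d"
  using assms hd_ternary_digits[of n] by (cases "ternary_digits n") auto

text \<open>Positivity excludes \<open>m = 0\<close>, whose digit list is \<open>[0]\<close>
  although the coefficient is 1.\<close>

lemma binomial_raney_dvd_iff:
  assumes "0 < m"
  shows "3 dvd (3 * m + 1) choose m \<longleftrightarrow> \<not> set (ternary_digits m) \<subseteq> {1}"
  using assms
proof (induction m rule: less_induct)
  case (less m)
  show ?case
  proof (cases m rule: nat_mod3_cases)
    case (0 k)
    then show ?thesis
      using less.prems binomial_raney_recursion(1)[of k] ternary_digits_snoc[of k 0]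
      by (auto simp: cong_0_iff)
  next
    case (1 k)
    have "3 dvd (3 * m + 1) choose m \<longleftrightarrow> 3 dvd (3 * k + 1) choose k"
      using binomial_raney_recursion(2)[of k] cong_dvd_iff 1 by blast
    then show ?thesis
      using less.IH[of k] 1 ternary_digits_snoc[of k 1]
      by (cases "k = 0") (auto simp: ternary_digits_less)
  next
    case (2 k)
    then show ?thesis
      using binomial_raney_recursion(3)[of k] ternary_digits_snoc[of k 2]
      by (cases "k = 0") (auto simp: cong_0_iff ternary_digits_less)
  qed
qed

text \<open>Both sides obey the same recursion in the last digit: a final 0 breaks sortedness for
  \<open>n > 0\<close>, a final 1 forces all earlier digits to be 1, and a final 2 imposes nothing
  on them.\<close>

lemma raney32_dvd_iff: "3 dvd raney32 n \<longleftrightarrow> \<not> sorted (ternary_digits n)"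
proof (induction n rule: less_induct)
  case (less n)
  show ?case
  proof (cases n rule: nat_mod3_cases)
    case (0 m)
    show ?thesis
    proof (cases "m = 0")
      case True
      then show ?thesis using 0 by (simp add: raney32_def ternary_digits_less)
    next
      case False
      then have "3 dvd raney32 n"
        using raney32_recursion(1)[of m] 0 by (simp add: cong_0_iff)
      moreover have "\<not> sorted (ternary_digits n)"
        using sorted_ternary_digits_pos[of n 0] ternary_digits_snoc[of m 0] 0 False by auto
      ultimately show ?thesis by simp
    qed
  next
    case (1 m)
    have "3 dvd raney32 n \<longleftrightarrow> 3 dvd 2 * ((3 * m + 1) choose m)"
      using raney32_recursion(2)[of m] cong_dvd_iff 1 by blast
    also have "\<dots> \<longleftrightarrow> 3 dvd (3 * m + 1) choose m"
      by presburger
    also have "\<dots> \<longleftrightarrow> \<not> sorted (ternary_digits n)"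
    proof (cases "m = 0")
      case True
      then show ?thesis using 1 by (simp add: ternary_digits_less)
    next
      case False
      have "sorted (ternary_digits n) \<longleftrightarrow> sorted (ternary_digits m) \<and> (\<forall>d\<in>set (ternary_digits m). d \<le> 1)"
        using False 1 ternary_digits_snoc[of m 1] by (simp add: sorted_append)
      \<comment> \<open>Zeros are ruled out by the nonzero leading digit, which brings the condition
        into the form of \<open>binomial_raney_dvd_iff\<close>.\<close>
      also have "\<dots> \<longleftrightarrow> set (ternary_digits m) \<subseteq> {1}"
      proof
        assume "sorted (ternary_digits m) \<and> (\<forall>d\<in>set (ternary_digits m). d \<le> 1)"
        then show "set (ternary_digits m) \<subseteq> {1}"
          using sorted_ternary_digits_pos[of m] False by (force simp: le_Suc_eq)
      next
        assume ones: "set (ternary_digits m) \<subseteq> {1}"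
        then have "ternary_digits m = replicate (length (ternary_digits m)) 1"
          by (intro replicate_eqI) auto
        then have "sorted (ternary_digits m)"
          using sorted_replicate by metis
        with ones show "sorted (ternary_digits m) \<and> (\<forall>d\<in>set (ternary_digits m). d \<le> 1)"
          by auto
      qed
      finally show ?thesis
        using binomial_raney_dvd_iff[of m] False by simp
    qed
    finally show ?thesis .
  next
    case (2 m)
    have "3 dvd raney32 n \<longleftrightarrow> 3 dvd raney32 m"
      using raney32_recursion(3)[of m] cong_dvd_iff 2 by blast
    also have "\<dots> \<longleftrightarrow> \<not> sorted (ternary_digits n)"
    proof (cases "m = 0")
      case True
      then show ?thesis using 2 by (simp add: raney32_def ternary_digits_less)
    next
      case False
      then have "sorted (ternary_digits n) \<longleftrightarrow> sorted (ternary_digits m)"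
        using 2 ternary_digits_snoc[of m 2] set_ternary_digits[of m] by (auto simp: sorted_append)
      then show ?thesis using less.IH[of m] 2 by simp
    qed
    finally show ?thesis .
  qed
qed

theorem theorem4p2:
  fixes n :: nat
  shows "(\<not> 3 dvd raney32 n \<longleftrightarrow> sorted (ternary_digits n)) \<and>
    (n = 0 \<or> (\<exists>j\<ge>1. n = ternary (replicate j 2)) \<longrightarrow> [raney32 n = 1] (mod 3)) \<and>
    ((\<exists>i\<ge>1. \<exists>j\<ge>0. n = ternary (replicate i 1 @ replicate j 2)) \<longrightarrow> [raney32 n = 2] (mod 3)) \<and>
    (\<not> (n = 0 \<or> (\<exists>j\<ge>1. n = ternary (replicate j 2))) \<and>
     \<not> (\<exists>i\<ge>1. \<exists>j\<ge>0. n = ternary (replicate i 1 @ replicate j 2)) \<longrightarrow> [raney32 n = 0] (mod 3))"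
proof (intro conjI impI)
  show "\<not> 3 dvd raney32 n \<longleftrightarrow> sorted (ternary_digits n)"
    by (simp add: raney32_dvd_iff)
next
  assume "n = 0 \<or> (\<exists>j\<ge>1. n = ternary (replicate j 2))"
  \<comment> \<open>The case \<open>n = 0\<close> is the empty string of twos,
    \<open>j = 0\<close>.\<close>
  then obtain j where "n = ternary (replicate j 2)"
    by (metis replicate_0 ternary_Nil)
  then show "[raney32 n = 1] (mod 3)"
    using raney32_twos by simp
next
  assume "\<exists>i\<ge>1. \<exists>j\<ge>0. n = ternary (replicate i 1 @ replicate j 2)"
  then show "[raney32 n = 2] (mod 3)"
    using raney32_ones_twos by blast
next
  assume other: "\<not> (n = 0 \<or> (\<exists>j\<ge>1. n = ternary (replicate j 2))) \<and>
    \<not> (\<exists>i\<ge>1. \<exists>j\<ge>0. n = ternary (replicate i 1 @ replicate j 2))"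
  show "[raney32 n = 0] (mod 3)"
  proof (rule ccontr)
    assume "\<not> [raney32 n = 0] (mod 3)"
    with other obtain j where j: "n = ternary (replicate j 2)"
      using raney32_nonzero[of n] by auto
    \<comment> \<open>Only \<open>j = 0\<close> remains, that is \<open>n = 0\<close>, which
      \<open>other\<close> excludes as well.\<close>
    with other have "\<not> 1 \<le> j" by blast
    with other j show False by (simp add: not_le)
  qed
qed

end
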